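(* For every integer $n\ge0$, $$P_{000}(n)=\sum_{j,k\ge0}q^{j^2+k^2+2j}{2n-k-2\brack j}_{q^2}{j\brack k}_{q^2}.$$
   Context: For partitions $\lambda=(\lambda_1,\lambda_2,\dots)$, $\mu=(\mu_1,\mu_2,\dots)$ (weakly decreasing, padded by zeros) write $\lambda\succeq\mu$ if $\lambda_1\ge\mu_1\ge\lambda_2\ge\mu_2\ge\cdots$ and $\lambda\preceq\mu$ if $\mu_1\ge\lambda_1\ge\mu_2\ge\lambda_2\ge\cdots$. A skew double shifted plane partition (DSPP) with profile $\delta=\delta_1\delta_2\delta_3\in\{0,1\}^3$ is a 4-tuple of integer partitions $(\lambda^0,\lambda^1,\lambda^2,\lambda^3)$ with $\lambda^{j-1}\succeq\lambda^j$ if $\delta_j=0$ and $\lambda^{j-1}\preceq\lambda^j$ if $\delta_j=1$ ($j=1,2,3$). Its size $|\Lambda|$ is the sum of all parts of the four partitions; its diagonal length is the maximum of the numbers of (positive) parts of the four partitions. Let $\mathrm{DSPP}_{000}(n)$ be the set of DSPPs with profile $000$ and diagonal length at most $n$, $F_{000}(n)=\sum_{\Lambda\in\mathrm{DSPP}_{000}(n)}q^{|\Lambda|}$, and $P_{000}(n)=(q;q)_{4n}F_{000}(n)$. Here $(a;q)_0=1$, $(a;q)_n=\prod_{i=0}^{n-1}(1-aq^i)$ for $n\ge1$, and ${n\brack m}_q=\frac{(q;q)_n}{(q;q)_m(q;q)_{n-m}}$ if $n\ge m\ge0$ and $0$ otherwise; ${n\brack m}_{q^2}$ is the same with $q\to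 q^2$.
   Formalization: The identity is proved for n ≥ 1 instead of n ≥ 0: at n = 0 every upper entry 2n−k−2 is negative, so with the stated convention for q-binomials the right side is 0, while P_000(0) = 1. *)

theory Defs
  imports "HOL-Analysis.Infinite_Sum" "HOL-Computational_Algebra.Formal_Power_Series"
begin

section \<open>Partitions and skew double shifted plane partitions\<close>

text \<open>A partition is the sequence of its parts padded by zeros; the part written
  \<open>\<lambda>\<^sub>i\<close> in the literature (\<open>i \<ge> 1\<close>) is \<open>l (i - 1)\<close> here.\<close>

definition is_partition :: "(nat \<Rightarrow> nat) \<Rightarrow> bool" where
  "is_partition l \<longleftrightarrow> antimono l \<and> finite {i. l i > 0}"

definition part_size :: "(nat \<Rightarrow> nat) \<Rightarrow> nat" where
  "part_size l = (\<Sum>i | l i > 0. l i)"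

definition part_length :: "(nat \<Rightarrow> nat) \<Rightarrow> nat" where
  "part_length l = card {i. l i > 0}"

definition interlaces :: "(nat \<Rightarrow> nat) \<Rightarrow> (nat \<Rightarrow> nat) \<Rightarrow> bool"  (infix "\<succeq>" 50) where
  "l \<succeq> m \<longleftrightarrow> (\<forall>i. l i \<ge> m i \<and> m i \<ge> l (Suc i))"

text \<open>The converse relation \<open>l \<preceq> m\<close> is \<open>m \<succeq> l\<close>.\<close>

definition dspp_step :: "nat \<Rightarrow> (nat \<Rightarrow> nat) \<Rightarrow> (nat \<Rightarrow> nat) \<Rightarrow> bool" where
  "dspp_step d l m \<longleftrightarrow> (d = 0 \<and> l \<succeq> m) \<or> (d = 1 \<and> m \<succeq> l)"

type_synonym part4 = "(nat \<Rightarrow> nat) \<times> (nat \<Rightarrow> nat) \<times> (nat \<Rightarrow> nat) \<times> (nat \<Rightarrow> nat)"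

fun is_dspp :: "nat \<times> nat \<times> nat \<Rightarrow> part4 \<Rightarrow> bool" where
  "is_dspp (d1, d2, d3) (l0, l1, l2, l3) \<longleftrightarrow>
     is_partition l0 \<and> is_partition l1 \<and> is_partition l2 \<and> is_partition l3 \<and>
     dspp_step d1 l0 l1 \<and> dspp_step d2 l1 l2 \<and> dspp_step d3 l2 l3"

fun dspp_size :: "part4 \<Rightarrow> nat" where
  "dspp_size (l0, l1, l2, l3) = part_size l0 + part_size l1 + part_size l2 + part_size l3"

fun diag_length :: "part4 \<Rightarrow> nat" where
  "diag_length (l0, l1, l2, l3) =
     Max {part_length l0, part_length l1, part_length l2, part_length l3}"

definition DSPP :: "nat \<times> nat \<times> nat \<Rightarrow> nat \<Rightarrow> part4 set" where
  "DSPP d n = {L. is_dspp d L \<and> diag_length L \<le> n}"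

lemma finite_bounded_partitions:
  "finite {l. is_partition l \<and> part_length l \<le> n \<and> part_size l \<le> N}"
proof -
  let ?S = "{f :: nat \<Rightarrow> nat. \<forall>i. (i \<in> {..<n} \<longrightarrow> f i \<in> {..N}) \<and> (i \<notin> {..<n} \<longrightarrow> f i = 0)}"
  have fin: "finite ?S"
    by (intro finite_set_of_finite_funs) auto
  have "l \<in> ?S" if l: "is_partition l" "part_length l \<le> n" "part_size l \<le> N" for l
  proof -
    have "l i \<le> N" for i
    proof (cases "l i > 0")
      case True
      then have "l i \<le> part_size l"
        using l(1) unfolding is_partition_def part_size_def
        by (intro member_le_sum) auto
      with l(3) show ?thesis by simp
    qed simp
    moreover have "l i = 0" if i: "i \<ge> n" for i
    proof (rule ccontr)
      assume "l i \<noteq> 0"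
      moreover have "l i \<le> l j" if "j \<le> i" for j
        using l(1) that unfolding is_partition_def by (auto dest: antimonoD)
      ultimately have "{..i} \<subseteq> {i. l i > 0}" by force
      then have "card {..i} \<le> part_length l"
        using l(1) unfolding is_partition_def part_length_def by (intro card_mono) auto
      with l(2) i show False by simp
    qed
    ultimately show ?thesis by auto
  qed
  then show ?thesis
    by (intro finite_subset[OF _ fin]) blast
qed

text \<open>There are only finitely many objects of each size, so the cardinalities in the
  generating function below are genuine counts.\<close>

lemma finite_DSPP_of_size: "finite {L \<in> DSPP d n. dspp_size L = N}"
proof -
  let ?A = "{l. is_partition l \<and> part_length l \<le> n \<and> part_size l \<le> N}"
  have "{L \<in> DSPP d n. dspp_size L = N} \<subseteq> ?A \<times> ?A \<times> ?A \<times> ?A"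
    by (cases d) (auto simp: DSPP_def)
  then show ?thesis
    by (rule finite_subset) (intro finite_cartesian_product finite_bounded_partitions)
qed

section \<open>q-analogues and generating functions\<close>

definition qpoch :: "'a::comm_ring_1 \<Rightarrow> 'a \<Rightarrow> nat \<Rightarrow> 'a" where
  "qpoch a q n = (\<Prod>i<n. 1 - a * q ^ i)"

text \<open>The arguments are integers, since the upper one may be negative.\<close>

definition qbinom :: "'a::{comm_ring_1,inverse} \<Rightarrow> int \<Rightarrow> int \<Rightarrow> 'a" where
  "qbinom q n m =
     (if n \<ge> m \<and> m \<ge> 0
      then qpoch q q (nat n) / (qpoch q q (nat m) * qpoch q q (nat (n - m))) else 0)"

text \<open>All identities live in \<open>rat fps\<close>, with \<open>q\<close> the formal variable \<open>fps_X\<close>; denominators of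
  q-binomials have constant coefficient 1, so the divisions are by units.\<close>

definition F_gen :: "nat \<times> nat \<times> nat \<Rightarrow> nat \<Rightarrow> rat fps" where
  "F_gen d n = Abs_fps (\<lambda>N. of_nat (card {L \<in> DSPP d n. dspp_size L = N}))"

definition P000 :: "nat \<Rightarrow> rat fps" where
  "P000 n = qpoch fps_X fps_X (4 * n) * F_gen (0, 0, 0) n"

text \<open>The case \<open>n = 0\<close>: the upper argument \<open>2 n - k - 2\<close> is negative for all \<open>k\<close>, so a sum
  over terms containing this q-binomial is zero, whereas \<open>P000 0 = 1\<close>.\<close>

lemma qbinom_upper_0: "qbinom q (2 * int 0 - int k - 2) (int j) = 0"
  by (simp add: qbinom_def)

lemma P000_0: "P000 0 = 1"
proof -
  have zero: "l = (\<lambda>_. 0)" if "is_partition l" "part_length l = 0" for l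
    using that by (auto simp: is_partition_def part_length_def)
  have "DSPP (0,0,0) 0 = {(\<lambda>_. 0, \<lambda>_. 0, \<lambda>_. 0, \<lambda>_. 0)}"
    by (auto simp: DSPP_def zero)
       (auto simp: is_partition_def part_length_def dspp_step_def interlaces_def antimono_def)
  then have "{L \<in> DSPP (0,0,0) 0. dspp_size L = N}
      = (if N = 0 then {(\<lambda>_. 0, \<lambda>_. 0, \<lambda>_. 0, \<lambda>_. 0)} else {})" for N
    by (auto simp: part_size_def)
  then show ?thesis
    by (auto simp: P000_def F_gen_def qpoch_def fps_eq_iff)
qed

end

theory Submission
  imports Defs
begin

text \<open>
  A double shifted plane partition of profile 000 and diagonal length at most \<open>n\<close> is an array of
  \<open>n\<close> rows of length 4, each row shifted one step to the right of the row above it, whose entries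
  decrease weakly along rows and columns.  It is thus a \<open>P\<close>-partition of a poset of \<open>4 n\<close> cells, and
  \<open>P000 n\<close> is the numerator \<open>(q;q)\<^bsub>|S|\<^esub> F\<^bsub>S\<^esub>\<close> of its generating function.

  Subtracting 1 everywhere shows that \<open>(1 - q\<^bsup>|S|\<^esup>) F\<^bsub>S\<^esub>\<close> counts the \<open>P\<close>-partitions having an entry
  equal to 0.  Such an entry can be found at a corner, that is, at a maximal cell; the shapes
  occurring here have at most two corners \<open>a\<close> and \<open>b\<close>, because the band has width two.
  Inclusion-exclusion over the corners (\<open>numerator_two_corners\<close>) gives
  \<open>N\<^bsub>S\<^esub> = N\<^bsub>S-a\<^esub> + N\<^bsub>S-b\<^esub> - (1 - q\<^bsup>|S|-1\<^esup>) N\<^bsub>S-a-b\<^esub>\<close>, and \<open>N\<^bsub>S\<^esub> = N\<^bsub>S-a\<^esub>\<close> if there is a single corner.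
  The order ideals reached from the full band by removing corners are \<open>e\<close> full rows followed by
  one of finitely many small tails.  Eliminating all tails except \<open>(2)\<close> and \<open>(3, 1)\<close> leaves one
  sequence \<open>X\<close>, with the tail \<open>(2)\<close> at the indices \<open>2 e\<close> and the tail \<open>(3, 1)\<close> at \<open>2 e + 1\<close>,
  which satisfies
  \<open>X\<^sub>m = (1 + q\<^bsup>2m+1\<^esup>) X\<^bsub>m-1\<^esub> + q\<^bsup>2m\<^esup> X\<^bsub>m-2\<^esub>\<close> (\<open>num_eq_band_poly\<close>), and \<open>P000 n\<close> is \<open>X\<close> at \<open>2 n - 2\<close> for \<open>n \<ge> 1\<close>.

  On the other side, the product of the two \<open>q\<close>-binomials is the \<open>q\<close>-multinomial coefficient
  of \<open>(m - j - k, j - k, k)\<close> in base \<open>q\<^sup>2\<close>, where \<open>m = 2 n - 2\<close>.  Its Pascal rule (\<open>qmultinom_rec\<close>)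
  is the recurrence of \<open>X\<close> already for each single pair \<open>(j, k)\<close> (\<open>summand_rec\<close>):
  the three terms come from \<open>(j, k)\<close>, \<open>(j - 1, k)\<close> and \<open>(j - 1, k - 1)\<close>.
\<close>

section \<open>Order-reversing maps and their generating functions\<close>

text \<open>Extending the maps by 0 outside \<open>S\<close> makes a \<open>P\<close>-partition that vanishes at a maximal element
  literally a \<open>P\<close>-partition of the smaller set, so that no restriction maps are needed.\<close>

definition ppartitions :: "('a \<Rightarrow> 'a \<Rightarrow> bool) \<Rightarrow> 'a set \<Rightarrow> ('a \<Rightarrow> nat) set" where
  "ppartitions le S = {f. (\<forall>x. x \<notin> S \<longrightarrow> f x = 0) \<and> (\<forall>x\<in>S. \<forall>y\<in>S. le x y \<longrightarrow> f y \<le> f x)}"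

definition ppartitions_of :: "('a \<Rightarrow> 'a \<Rightarrow> bool) \<Rightarrow> 'a set \<Rightarrow> nat \<Rightarrow> ('a \<Rightarrow> nat) set" where
  "ppartitions_of le S N = {f \<in> ppartitions le S. sum f S = N}"

definition ppartition_gf :: "('a \<Rightarrow> 'a \<Rightarrow> bool) \<Rightarrow> 'a set \<Rightarrow> rat fps" where
  "ppartition_gf le S = Abs_fps (\<lambda>N. of_nat (card (ppartitions_of le S N)))"

definition numerator :: "('a \<Rightarrow> 'a \<Rightarrow> bool) \<Rightarrow> 'a set \<Rightarrow> rat fps" where
  "numerator le S = qpoch fps_X fps_X (card S) * ppartition_gf le S"

lemma finite_ppartitions_of:
  assumes "finite S"
  shows "finite (ppartitions_of le S N)"
proof -
  let ?F = "{f. \<forall>x. (x \<in> S \<longrightarrow> f x \<in> {..N}) \<and> (x \<notin> S \<longrightarrow> f x = 0)}"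
  have "finite ?F"
    using assms by (intro finite_set_of_finite_funs) auto
  moreover have "ppartitions_of le S N \<subseteq> ?F"
    using assms by (auto simp: ppartitions_of_def ppartitions_def intro: member_le_sum)
  ultimately show ?thesis
    by (rule finite_subset[rotated])
qed

lemma ppartitions_vanishing_at:
  assumes "\<And>y. y \<in> S \<Longrightarrow> le a y \<Longrightarrow> y = a"
  shows "{f \<in> ppartitions le S. f a = 0} = ppartitions le (S - {a})"
proof -
  have "f \<in> ppartitions le S" if "f \<in> ppartitions le (S - {a})" for f
    unfolding ppartitions_def mem_Collect_eq
  proof (intro conjI allI ballI impI)
    fix x y assume "x \<in> S" "y \<in> S" "le x y"
    with that assms[of y] show "f y \<le> f x"
      by (cases "x = a \<or> y = a") (auto simp: ppartitions_def)
  qed (use that in \<open>auto simp: ppartitions_def\<close>)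
  then show ?thesis
    by (auto simp: ppartitions_def)
qed

lemma ppartitions_of_vanishing_at:
  assumes "finite S" "a \<in> S" "\<And>y. y \<in> S \<Longrightarrow> le a y \<Longrightarrow> y = a"
  shows "{f \<in> ppartitions_of le S N. f a = 0} = ppartitions_of le (S - {a}) N"
proof -
  have "sum f S = f a + sum f (S - {a})" for f :: "'a \<Rightarrow> nat"
    using assms by (simp add: sum.remove)
  then show ?thesis
    using ppartitions_vanishing_at[of S le a] assms(3)
    unfolding ppartitions_of_def by (auto simp: set_eq_iff)
qed

text \<open>Adding 1 to every entry is the bijection.\<close>

lemma card_positive_ppartitions_of:
  assumes "finite S"
  shows "card {f \<in> ppartitions_of le S N. \<forall>x\<in>S. 0 < f x} =
    (if card S \<le> N then card (ppartitions_of le S (N - card S)) else 0)"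
proof (cases "card S \<le> N")
  case True
  let ?up = "\<lambda>f x. if x \<in> S then f x + 1 else (0::nat)"
  let ?down = "\<lambda>f x. f x - (1::nat)"
  let ?pos = "{f \<in> ppartitions_of le S N. \<forall>x\<in>S. 0 < f x}"
  have "bij_betw ?up (ppartitions_of le S (N - card S)) ?pos"
  proof (rule bij_betw_byWitness[where f' = ?down])
    show "\<forall>f\<in>ppartitions_of le S (N - card S). ?down (?up f) = f"
      by (auto simp: ppartitions_of_def ppartitions_def)
    show "\<forall>f\<in>?pos. ?up (?down f) = f"
      by (auto simp: ppartitions_of_def ppartitions_def fun_eq_iff)
    have "sum (?up f) S = sum f S + card S" for f :: "'a \<Rightarrow> nat"
      by (simp add: sum_Suc)
    then show "?up ` ppartitions_of le S (N - card S) \<subseteq> ?pos"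
      using True by (auto simp: ppartitions_of_def ppartitions_def less_Suc_eq_le)
    have "sum (?down f) S = sum f S - card S" if "\<forall>x\<in>S. 0 < f x" for f :: "'a \<Rightarrow> nat"
      using that by (simp add: sum_subtractf_nat Suc_le_eq)
    then show "?down ` ?pos \<subseteq> ppartitions_of le S (N - card S)"
      by (auto simp: ppartitions_of_def ppartitions_def diff_le_mono)
  qed
  then show ?thesis
    using True by (simp add: bij_betw_same_card)
next
  case False
  have "card S \<le> N" if "f \<in> ppartitions_of le S N" "\<forall>x\<in>S. 0 < f x" for f
    using that sum_mono[of S "\<lambda>_. 1" f] by (auto simp: ppartitions_of_def Suc_le_eq)
  then show ?thesis
    using False by (auto simp: card_eq_0_iff)
qed

text \<open>Every entry is bounded below by the entry at \<open>a\<close> or by that at \<open>b\<close>, so a \<open>P\<close>-partition has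
  only positive entries or vanishes at one of the two.  The case \<open>a = b\<close> is included and
  treats sets with a greatest element.\<close>

lemma ppartition_gf_two_corners:
  assumes S: "finite S" "a \<in> S" "b \<in> S"
    and max_a: "\<And>y. y \<in> S \<Longrightarrow> le a y \<Longrightarrow> y = a"
    and max_b: "\<And>y. y \<in> S \<Longrightarrow> le b y \<Longrightarrow> y = b"
    and below: "\<And>x. x \<in> S \<Longrightarrow> le x a \<or> le x b"
  shows "(1 - fps_X ^ card S) * ppartition_gf le S =
    ppartition_gf le (S - {a}) + ppartition_gf le (S - {b}) - ppartition_gf le (S - {a, b})"
proof (rule fps_ext)
  fix N
  let ?P = "\<lambda>T. ppartitions_of le T N"
  let ?pos = "{f \<in> ?P S. \<forall>x\<in>S. 0 < f x}"
  have A: "{f \<in> ?P S. f a = 0} = ?P (S - {a})" and B: "{f \<in> ?P S. f b = 0} = ?P (S - {b})"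
    by (rule ppartitions_of_vanishing_at; use S max_a max_b in blast)+
  have AB: "?P (S - {a}) \<inter> ?P (S - {b}) = ?P (S - {a, b})"
  proof (cases "a = b")
    case False
    have "{f \<in> ?P (S - {a}). f b = 0} = ?P (S - {a} - {b})"
      by (rule ppartitions_of_vanishing_at) (use S max_b False in auto)
    moreover have "S - {a} - {b} = S - {a, b}"
      by auto
    ultimately show ?thesis
      using A B by auto
  qed simp
  have "f a \<le> f x \<or> f b \<le> f x" if "f \<in> ?P S" "x \<in> S" for f x
    using that below[of x] S by (auto simp: ppartitions_of_def ppartitions_def)
  then have "?P S = ?pos \<union> (?P (S - {a}) \<union> ?P (S - {b}))"
    unfolding A[symmetric] B[symmetric] by fastforce
  moreover have "?pos \<inter> (?P (S - {a}) \<union> ?P (S - {b})) = {}"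
    unfolding A[symmetric] B[symmetric] using S by auto
  moreover have fin: "finite (?P T)" if "T \<subseteq> S" for T
    using finite_subset[OF that S(1)] by (rule finite_ppartitions_of)
  ultimately have "card (?P S) = card ?pos + card (?P (S - {a}) \<union> ?P (S - {b}))"
    by (metis (no_types, lifting) card_Un_disjoint finite_Un order_refl)
  moreover have "card (?P (S - {a})) + card (?P (S - {b})) =
      card (?P (S - {a}) \<union> ?P (S - {b})) + card (?P (S - {a, b}))"
    using card_Un_Int[of "?P (S - {a})" "?P (S - {b})"] fin AB by simp
  ultimately have "card (?P S) + card (?P (S - {a, b})) =
      card ?pos + (card (?P (S - {a})) + card (?P (S - {b})))"
    by simp
  from arg_cong[OF this, of "of_nat :: nat \<Rightarrow> rat"]
  show "fps_nth ((1 - fps_X ^ card S) * ppartition_gf le S) N =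
      fps_nth (ppartition_gf le (S - {a}) + ppartition_gf le (S - {b})
        - ppartition_gf le (S - {a, b})) N"
    using card_positive_ppartitions_of[OF S(1), of le N]
    by (auto simp: ppartition_gf_def left_diff_distrib fps_X_power_mult_nth not_le split: if_splits)
qed

lemma qpoch_Suc: "qpoch a q (Suc n) = qpoch a q n * (1 - a * q ^ n)"
  by (simp add: qpoch_def)

lemma numerator_empty: "numerator le {} = 1"
proof -
  have "ppartitions_of le {} N = (if N = 0 then {\<lambda>_. 0} else {})" for N
    by (auto simp: ppartitions_of_def ppartitions_def)
  then show ?thesis
    by (auto simp: numerator_def qpoch_def ppartition_gf_def fps_eq_iff)
qed

lemma numerator_one_corner:
  assumes "finite S" "a \<in> S" "\<And>y. y \<in> S \<Longrightarrow> le a y \<Longrightarrow> y = a" "\<And>x. x \<in> S \<Longrightarrow> le x a"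
    and "S - {a} = T"
  shows "numerator le S = numerator le T"
proof -
  have "card S = Suc (card T)"
    using assms(1,2,5) by (metis card_Suc_Diff1)
  moreover have "(1 - fps_X ^ card S) * ppartition_gf le S = ppartition_gf le T"
    using ppartition_gf_two_corners[of S a a le] assms by auto
  ultimately show ?thesis
    by (simp add: numerator_def qpoch_Suc mult.assoc)
qed

lemma numerator_two_corners:
  assumes S: "finite S" "a \<in> S" "b \<in> S" "a \<noteq> b"
    and "\<And>y. y \<in> S \<Longrightarrow> le a y \<Longrightarrow> y = a" "\<And>y. y \<in> S \<Longrightarrow> le b y \<Longrightarrow> y = b"
      "\<And>x. x \<in> S \<Longrightarrow> le x a \<or> le x b"
    and T: "S - {a} = A" "S - {b} = B" "S - {a, b} = C"
  shows "numerator le S =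
    numerator le A + numerator le B - (1 - fps_X ^ Suc (card C)) * numerator le C"
proof -
  have card: "card A = Suc (card C)" "card B = Suc (card C)" "card S = Suc (Suc (card C))"
    using card_Diff_singleton[of a S] card_Diff_singleton[of b S] card_Diff_subset[of "{a,b}" S]
      card_mono[of S "{a,b}"] S T by auto
  have "(1 - fps_X ^ card S) * ppartition_gf le S =
      ppartition_gf le A + ppartition_gf le B - ppartition_gf le C"
    using ppartition_gf_two_corners[of S a b le] assms by blast
  moreover have "numerator le S = qpoch fps_X fps_X (card C) * (1 - fps_X ^ Suc (card C))
      * ((1 - fps_X ^ card S) * ppartition_gf le S)"
    by (simp add: numerator_def qpoch_Suc card mult.assoc)
  ultimately have "numerator le S = qpoch fps_X fps_X (card C) * (1 - fps_X ^ Suc (card C))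
      * (ppartition_gf le A + ppartition_gf le B - ppartition_gf le C)"
    by simp
  then show ?thesis
    by (simp add: numerator_def qpoch_Suc card algebra_simps)
qed

section \<open>Shapes in the band of four diagonals\<close>

text \<open>The pair \<open>(r, d)\<close> is the cell of the \<open>d\<close>-th diagonal in row \<open>r\<close>, so its column is \<open>r + d\<close>;
  this is the componentwise order on (row, column).\<close>

definition cell_le :: "nat \<times> nat \<Rightarrow> nat \<times> nat \<Rightarrow> bool" where
  "cell_le = (\<lambda>(r, d) (r', d'). r \<le> r' \<and> r + d \<le> r' + d')"

text \<open>\<open>e\<close> full rows of four cells, followed by three rows of \<open>a\<close>, \<open>b\<close> and \<open>c\<close> cells.  A row length
  never exceeds 4, and each partial row used below ends no further right than the row above it.\<close>

definition cells :: "nat \<Rightarrow> nat \<Rightarrow> nat \<Rightarrow> nat \<Rightarrow> (nat \<times> nat) set" where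
  "cells e a b c = {(r, d). d < (if r < e then 4 else if r = e then a
     else if r = e + 1 then b else if r = e + 2 then c else 0)}"

abbreviation num :: "nat \<Rightarrow> nat \<Rightarrow> nat \<Rightarrow> nat \<Rightarrow> rat fps" where
  "num e a b c \<equiv> numerator cell_le (cells e a b c)"

lemma cells_eq:
  "cells e a b c = {..<e} \<times> {..<4} \<union> ({e} \<times> {..<a} \<union> ({e + 1} \<times> {..<b} \<union> {e + 2} \<times> {..<c}))"
  by (auto simp: cells_def split: if_splits)

lemma finite_cells: "finite (cells e a b c)"
  by (simp add: cells_eq)

lemma card_cells: "card (cells e a b c) = 4 * e + a + b + c"
  unfolding cells_eq
  by (subst card_Un_disjoint; (simp add: card_cartesian_product)?;
      (subst card_Un_disjoint; (simp add: card_cartesian_product)?;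
       (subst card_Un_disjoint; (simp add: card_cartesian_product)?)?)?) auto

text \<open>If the last row of a shape reaches at least as far to the right as the rows above it, its
  last cell is the only corner; this covers the next four lemmas.\<close>

lemma num_3: "num e 3 0 0 = num e 2 0 0"
  by (rule numerator_one_corner[where a = "(e, 2)"])
     (auto simp: finite_cells, auto simp: cells_def cell_le_def split: if_splits)

lemma num_full_rows: "num (Suc e) 0 0 0 = num e 2 0 0"
proof -
  have "num (Suc e) 0 0 0 = num e 3 0 0"
    by (rule numerator_one_corner[where a = "(e, 3)"])
       (auto simp: finite_cells, auto simp: cells_def cell_le_def split: if_splits)
  then show ?thesis
    by (simp add: num_3)
qed

lemma num_3_2: "num e 3 2 0 = num e 3 1 0"
  by (rule numerator_one_corner[where a = "(e + 1, 1)"])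
     (auto simp: finite_cells, auto simp: cells_def cell_le_def split: if_splits)

lemma num_3_2_1: "num e 3 2 1 = num e 3 1 0"
proof -
  have "num e 3 2 1 = num e 3 2 0"
    by (rule numerator_one_corner[where a = "(e + 2, 0)"])
       (auto simp: finite_cells, auto simp: cells_def cell_le_def split: if_splits)
  then show ?thesis
    by (simp add: num_3_2)
qed

text \<open>The four shapes with two corners.  Removing the end of the last full row turns \<open>e + 1\<close>
  full rows into \<open>e\<close> full rows followed by a row of three cells.  After
  the one-corner reductions, the numerator of the shape that lacks both corners agrees with that
  of one of the shapes that lack just one, hence the cancellation that leaves two terms.\<close>

lemma num_Suc_1:
  "num (Suc e) 1 0 0 = num e 3 1 0 + fps_X ^ (4 * e + 4) * num e 2 0 0"
proof -
  have "num (Suc e) 1 0 0 = num e 3 1 0 + num (Suc e) 0 0 0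
      - (1 - fps_X ^ Suc (card (cells e 3 0 0))) * num e 3 0 0"
    by (rule numerator_two_corners[where a = "(e, 3)" and b = "(Suc e, 0)"])
       (auto simp: finite_cells, auto simp: cells_def cell_le_def split: if_splits)
  then show ?thesis
    by (simp add: card_cells num_full_rows num_3 algebra_simps)
qed

lemma num_Suc_2:
  "num (Suc e) 2 0 0 = num (Suc e) 1 0 0 + fps_X ^ (4 * e + 5) * num e 3 1 0"
proof -
  have "num (Suc e) 2 0 0 = num e 3 2 0 + num (Suc e) 1 0 0
      - (1 - fps_X ^ Suc (card (cells e 3 1 0))) * num e 3 1 0"
    by (rule numerator_two_corners[where a = "(e, 3)" and b = "(Suc e, 1)"])
       (auto simp: finite_cells, auto simp: cells_def cell_le_def split: if_splits)
  then show ?thesis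
    by (simp add: card_cells num_3_2 algebra_simps)
qed

lemma num_3_1: "num e 3 1 0 = num e 2 1 0 + fps_X ^ (4 * e + 3) * num e 2 0 0"
proof -
  have "num e 3 1 0 = num e 2 1 0 + num e 3 0 0
      - (1 - fps_X ^ Suc (card (cells e 2 0 0))) * num e 2 0 0"
    by (rule numerator_two_corners[where a = "(e, 2)" and b = "(e + 1, 0)"])
       (auto simp: finite_cells, auto simp: cells_def cell_le_def split: if_splits)
  moreover have "Suc (card (cells e 2 0 0)) = 4 * e + 3"
    by (simp add: card_cells)
  ultimately show ?thesis
    by (simp add: num_3 left_diff_distrib)
qed

lemma num_Suc_2_1:
  "num (Suc e) 2 1 0 = num (Suc e) 2 0 0 + fps_X ^ (4 * e + 6) * num e 3 1 0"
proof -
  have "num (Suc e) 2 1 0 = num e 3 2 1 + num (Suc e) 2 0 0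
      - (1 - fps_X ^ Suc (card (cells e 3 2 0))) * num e 3 2 0"
    by (rule numerator_two_corners[where a = "(e, 3)" and b = "(e + 2, 0)"])
       (auto simp: finite_cells, auto simp: cells_def cell_le_def split: if_splits)
  then show ?thesis
    by (simp add: card_cells num_3_2 num_3_2_1[simplified] algebra_simps)
qed

lemma num_0_2: "num 0 2 0 0 = 1"
proof -
  have "num 0 2 0 0 = num 0 1 0 0"
    by (rule numerator_one_corner[where a = "(0, 1)"])
       (auto simp: finite_cells, auto simp: cells_def cell_le_def split: if_splits)
  also have "\<dots> = num 0 0 0 0"
    by (rule numerator_one_corner[where a = "(0, 0)"])
       (auto simp: finite_cells, auto simp: cells_def cell_le_def split: if_splits)
  also have "cells 0 0 0 0 = {}"
    by (auto simp: cells_def)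
  finally show ?thesis
    by (simp add: numerator_empty)
qed

lemma num_0_2_1: "num 0 2 1 0 = num 0 2 0 0"
  by (rule numerator_one_corner[where a = "(1, 0)"])
     (auto simp: finite_cells, auto simp: cells_def cell_le_def split: if_splits)

section \<open>The three-term recurrence\<close>

text \<open>The second value is what the recurrence gives from \<open>X\<^sub>0 = 1\<close> and \<open>X\<^bsub>-1\<^esub> = 0\<close>.\<close>

fun band_poly :: "nat \<Rightarrow> rat fps" where
  "band_poly 0 = 1"
| "band_poly (Suc 0) = 1 + fps_X ^ 3"
| "band_poly (Suc (Suc m)) = (1 + fps_X ^ (2 * m + 5)) * band_poly (Suc m) + fps_X ^ (2 * m + 4) * band_poly m"

lemma num_eq_band_poly: "num e 2 0 0 = band_poly (2 * e) \<and> num e 3 1 0 = band_poly (2 * e + 1)"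
proof (induction e)
  case 0
  then show ?case
    using num_3_1[of 0] num_0_2_1 by (simp add: num_0_2)
next
  case (Suc e)
  have "num (Suc e) 2 0 0 = band_poly (2 * Suc e)"
    using Suc num_Suc_1[of e] num_Suc_2[of e] by (simp add: algebra_simps)
  moreover from this have "num (Suc e) 3 1 0 = band_poly (2 * Suc e + 1)"
    using Suc num_3_1[of "Suc e"] num_Suc_2_1[of e] by (simp add: algebra_simps)
  ultimately show ?case ..
qed

section \<open>Double shifted plane partitions as maps on the band\<close>

lemma support_subset_lessThan:
  fixes l :: "nat \<Rightarrow> nat"
  assumes "\<And>i. n \<le> i \<Longrightarrow> l i = 0"
  shows "{i. 0 < l i} \<subseteq> {..<n}"
proof
  fix i assume "i \<in> {i. 0 < l i}"
  with assms[of i] show "i \<in> {..<n}"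
    by (cases "n \<le> i") auto
qed

lemma part_length_le_iff:
  assumes "is_partition l"
  shows "part_length l \<le> n \<longleftrightarrow> (\<forall>i\<ge>n. l i = 0)"
proof
  assume "\<forall>i\<ge>n. l i = 0"
  then have "{i. l i > 0} \<subseteq> {..<n}"
    by (intro support_subset_lessThan) simp
  from card_mono[OF _ this] show "part_length l \<le> n"
    by (simp add: part_length_def)
next
  assume len: "part_length l \<le> n"
  show "\<forall>i\<ge>n. l i = 0"
  proof (intro allI impI, rule ccontr)
    fix i assume "n \<le> i" "l i \<noteq> 0"
    have "0 < l j" if "j \<le> i" for j
    proof -
      have "l i \<le> l j"
        using assms that by (simp add: is_partition_def antimono_def)
      with \<open>l i \<noteq> 0\<close> show ?thesis
        by simp
    qed
    then have "{..i} \<subseteq> {i. l i > 0}"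
      by auto
    then have "card {..i} \<le> part_length l"
      using assms unfolding is_partition_def part_length_def by (intro card_mono) auto
    with len \<open>n \<le> i\<close> show False
      by simp
  qed
qed

lemma part_size_eq:
  assumes "\<forall>i\<ge>n. l i = 0"
  shows "part_size l = (\<Sum>i<n. l i)"
  unfolding part_size_def
proof (rule sum.mono_neutral_left)
  show "{i. 0 < l i} \<subseteq> {..<n}"
    using assms by (intro support_subset_lessThan) simp
qed auto

lemma cells_full: "cells n 0 0 0 = {..<n} \<times> {0, 1, 2, 3}"
  by (auto simp: cells_eq)

text \<open>The interlacing conditions say only that an entry bounds its right neighbour
  (the next diagonal of the same row) and the entry below it (the previous diagonal of the next
  row).  Two comparable cells of the band are joined by such steps inside the band: go right
  when column and diagonal allow it, and down otherwise.\<close>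

lemma cell_le_generated:
  fixes g :: "nat \<Rightarrow> nat \<Rightarrow> nat"
  assumes right: "\<And>r d. d < 3 \<Longrightarrow> g r (Suc d) \<le> g r d"
    and down: "\<And>r d. d < 3 \<Longrightarrow> g (Suc r) d \<le> g r (Suc d)"
    and "cell_le (r, d) (r', d')" "d < 4" "d' < 4"
  shows "g r' d' \<le> g r d"
  using assms(3-5)
proof (induction "r' - r + (r' + d' - (r + d))" arbitrary: r d rule: less_induct)
  case less
  show ?case
  proof (cases "r = r' \<and> d = d'")
    case ne: False
    show ?thesis
    proof (cases "r + d < r' + d' \<and> d < 3")
      case True
      then have "g r' d' \<le> g r (Suc d)"
        using less.prems by (intro less.hyps) (auto simp: cell_le_def)
      with right[of d r] True show ?thesis
        by simp
    next
      case False
      then have "0 < d" "r < r'"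
        using less.prems ne by (auto simp: cell_le_def)
      then have "g r' d' \<le> g (Suc r) (d - 1)"
        using less.prems by (intro less.hyps) (auto simp: cell_le_def)
      moreover have "g (Suc r) (d - 1) \<le> g r d"
        using down[of "d - 1" r] \<open>0 < d\<close> \<open>d < 4\<close> by simp
      ultimately show ?thesis
        by simp
    qed
  qed simp
qed

text \<open>The four partitions of a tuple are the diagonals of the array.\<close>

lemma card_DSPP_000:
  "card {L \<in> DSPP (0, 0, 0) n. dspp_size L = N} = card (ppartitions_of cell_le (cells n 0 0 0) N)"
proof -
  let ?D = "{L \<in> DSPP (0, 0, 0) n. dspp_size L = N}"
  let ?P = "ppartitions_of cell_le (cells n 0 0 0) N"
  let ?to = "\<lambda>f :: nat \<times> nat \<Rightarrow> nat. (\<lambda>r. f (r, 0), \<lambda>r. f (r, 1), \<lambda>r. f (r, 2), \<lambda>r. f (r, 3))"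
  let ?from = "\<lambda>(l0, l1, l2, l3) (r :: nat, d :: nat). if d = 0 then l0 r else if d = 1 then l1 r
      else if d = 2 then l2 r else if d = 3 then l3 r else (0 :: nat)"
  have size: "sum f (cells n 0 0 0) = (\<Sum>r<n. f (r, 0)) + (\<Sum>r<n. f (r, 1))
      + (\<Sum>r<n. f (r, 2)) + (\<Sum>r<n. f (r, 3))" for f :: "nat \<times> nat \<Rightarrow> nat"
    using sum.cartesian_product[of "\<lambda>r d. f (r, d)" "{0, 1, 2, 3}" "{..<n}"]
    by (simp add: cells_full sum.distrib add.assoc)
  have to: "?to f \<in> ?D" if "f \<in> ?P" for f
  proof -
    have zero: "f (r, d) = 0" if "n \<le> r" for r d
      using \<open>f \<in> ?P\<close> that by (auto simp: ppartitions_of_def ppartitions_def cells_full)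
    have mono: "f (r', d') \<le> f (r, d)" if "cell_le (r, d) (r', d')" "d < 4" "d' < 4" for r d r' d'
    proof (cases "r' < n")
      case True
      with that have "(r, d) \<in> cells n 0 0 0" "(r', d') \<in> cells n 0 0 0"
        by (auto simp: cells_def cell_le_def)
      with \<open>f \<in> ?P\<close> that show ?thesis
        by (auto simp: ppartitions_of_def ppartitions_def)
    qed (simp add: zero)
    have part: "is_partition (\<lambda>r. f (r, d))" if "d < 4" for d
    proof -
      have "{r. f (r, d) > 0} \<subseteq> {..<n}"
        using zero by (rule support_subset_lessThan)
      then have "finite {r. f (r, d) > 0}"
        by (rule finite_subset) simp
      moreover have "f (s, d) \<le> f (r, d)" if "r \<le> s" for r s
        using that \<open>d < 4\<close> by (intro mono) (auto simp: cell_le_def)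
      ultimately show ?thesis
        by (auto simp: is_partition_def antimono_def)
    qed
    have "part_length (\<lambda>r. f (r, d)) \<le> n" if "d < 4" for d
      using part_length_le_iff[OF part[OF that]] zero by simp
    moreover have "part_size (\<lambda>r. f (r, d)) = (\<Sum>r<n. f (r, d))" for d
      by (rule part_size_eq) (simp add: zero)
    moreover have "sum f (cells n 0 0 0) = N"
      using that by (simp add: ppartitions_of_def)
    ultimately show ?thesis
      using part
      by (simp add: DSPP_def dspp_step_def interlaces_def size del: One_nat_def)
         (auto intro!: mono simp: cell_le_def)
  qed
  have from_D: "?from L \<in> ?P" if D: "L \<in> ?D" for L
  proof -
    obtain l0 l1 l2 l3 where L: "L = (l0, l1, l2, l3)"
      by (cases L)
    have part: "is_partition l0" "is_partition l1" "is_partition l2" "is_partition l3"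
      and inter: "l0 \<succeq> l1" "l1 \<succeq> l2" "l2 \<succeq> l3"
      using D by (auto simp: L DSPP_def dspp_step_def)
    have zero: "\<forall>i\<ge>n. l0 i = 0" "\<forall>i\<ge>n. l1 i = 0" "\<forall>i\<ge>n. l2 i = 0" "\<forall>i\<ge>n. l3 i = 0"
      using D part by (auto simp: L DSPP_def part_length_le_iff)
    have mono: "?from L (r', d') \<le> ?from L (r, d)"
      if "cell_le (r, d) (r', d')" "d < 4" "d' < 4" for r d r' d'
      by (rule cell_le_generated[OF _ _ that, where g = "\<lambda>r d. ?from L (r, d)"])
         (use inter in \<open>auto simp: L interlaces_def less_Suc_eq numeral_eq_Suc\<close>)
    have "sum (?from L) (cells n 0 0 0) = N"
      using D zero by (simp add: L size part_size_eq)
    moreover have "?from L x = 0" if "x \<notin> cells n 0 0 0" for x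
      using that zero by (cases x) (auto simp: L cells_full)
    moreover have "?from L y \<le> ?from L x"
      if "x \<in> cells n 0 0 0" "y \<in> cells n 0 0 0" "cell_le x y" for x y
      using that mono[of "fst x" "snd x" "fst y" "snd y"] by (auto simp: cells_full)
    ultimately show ?thesis
      unfolding ppartitions_of_def ppartitions_def by blast
  qed
  have "bij_betw ?to ?P ?D"
  proof (rule bij_betw_byWitness[where f' = ?from])
    show "\<forall>f\<in>?P. ?from (?to f) = f"
      by (auto simp: fun_eq_iff ppartitions_of_def ppartitions_def cells_full)
    show "\<forall>L\<in>?D. ?to (?from L) = L"
      by auto
    show "?to ` ?P \<subseteq> ?D"
      using to by blast
    show "?from ` ?D \<subseteq> ?P"
      using from_D by blast
  qed
  then show ?thesis
    by (simp add: bij_betw_same_card)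
qed

lemma P000_eq_num: "P000 n = num n 0 0 0"
  by (simp add: P000_def F_gen_def numerator_def ppartition_gf_def card_DSPP_000 card_cells)

section \<open>The double sum\<close>

definition summand :: "nat \<Rightarrow> nat \<Rightarrow> nat \<Rightarrow> rat fps" where
  "summand m j k = fps_X ^ (j^2 + k^2 + 2 * j)
     * qbinom (fps_X^2) (int m - int k) (int j) * qbinom (fps_X^2) (int j) (int k)"

definition qfact :: "nat \<Rightarrow> rat fps" where
  "qfact i = qpoch (fps_X^2) (fps_X^2) i"

lemma qfact_Suc: "qfact (Suc i) = (1 - fps_X ^ (2 * Suc i)) * qfact i"
  by (simp add: qfact_def qpoch_Suc power_mult[symmetric] power_add[symmetric] mult.commute)

lemma qfact_nth_0: "fps_nth (qfact i) 0 = 1"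
  by (induction i) (simp add: qfact_def qpoch_def, simp add: qfact_Suc)

lemma inverse_qfact_Suc: "(1 - fps_X ^ (2 * Suc i)) * inverse (qfact (Suc i)) = inverse (qfact i)"
proof -
  have "inverse (qfact (Suc i)) = inverse (1 - fps_X ^ (2 * Suc i)) * inverse (qfact i)"
    by (simp add: qfact_Suc fps_inverse_mult)
  moreover have "(1 - fps_X ^ (2 * Suc i)) * inverse (1 - fps_X ^ (2 * Suc i) :: rat fps) = 1"
    by (rule inverse_mult_eq_1') simp
  ultimately show ?thesis
    by (simp only: mult.assoc[symmetric] mult_1_left)
qed

lemma qfact_mult_inverse: "qfact i * inverse (qfact i) = 1"
  by (rule inverse_mult_eq_1') (simp add: qfact_nth_0)

definition qmultinom :: "nat \<Rightarrow> nat \<Rightarrow> nat \<Rightarrow> rat fps" where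
  "qmultinom a b c = qfact (a + b + c) * inverse (qfact a) * inverse (qfact b) * inverse (qfact c)"

lemma summand_eq:
  "summand m j k = (if k \<le> j \<and> j + k \<le> m
     then fps_X ^ (j^2 + k^2 + 2 * j) * qmultinom (m - j - k) (j - k) k else 0)"
proof (cases "k \<le> j \<and> j + k \<le> m")
  case True
  then have nat: "nat (int m - int k) = m - k" "nat (int m - int k - int j) = m - j - k"
    "nat (int j - int k) = j - k" "m - j - k + (j - k) + k = m - k"
    by auto
  have "summand m j k = fps_X ^ (j^2 + k^2 + 2 * j)
      * (qfact (m - k) * (inverse (qfact j) * inverse (qfact (m - j - k))))
      * (qfact j * (inverse (qfact k) * inverse (qfact (j - k))))"
    using True nat
    by (simp add: summand_def qbinom_def qfact_def[symmetric] fps_divide_unit qfact_nth_0 fps_inverse_mult)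
  also have "\<dots> = fps_X ^ (j^2 + k^2 + 2 * j) * qmultinom (m - j - k) (j - k) k
      * (qfact j * inverse (qfact j))"
    unfolding qmultinom_def nat(4) by (simp only: mult_ac)
  finally show ?thesis
    using True by (simp add: qfact_mult_inverse)
qed (auto simp: summand_def qbinom_def)

lemma summand_eq_0: "m < j \<or> m < k \<Longrightarrow> summand m j k = 0"
  by (auto simp: summand_eq)

text \<open>Writing \<open>[i]\<close> for \<open>1 - Q\<^bsup>i\<^esup>\<close> with \<open>Q = q\<^sup>2\<close>, this is
  \<open>[a + b + c] = [a] + Q\<^bsup>a\<^esup> [c] + Q\<^bsup>a+c\<^esup> [b]\<close>, where each \<open>[i]\<close> lowers the factorial of its index.
  The exponents are those that the double sum requires: the part \<open>c\<close> is split off before \<open>b\<close>.\<close>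

lemma qmultinom_rec:
  assumes "0 < a + b + c"
  shows "qmultinom a b c = (if a = 0 then 0 else qmultinom (a - 1) b c)
    + fps_X ^ (2 * (a + c)) * (if b = 0 then 0 else qmultinom a (b - 1) c)
    + fps_X ^ (2 * a) * (if c = 0 then 0 else qmultinom a b (c - 1))"
proof -
  obtain s where s: "a + b + c = Suc s"
    using assms gr0_implies_Suc by blast
  \<comment> \<open>The factor \<open>[i]\<close> cancels against \<open>1 / qfact i\<close>, and vanishes for \<open>i = 0\<close>.\<close>
  define h where "h i = (if i = 0 then 0 else inverse (qfact (i - 1)))" for i
  have h: "h i = (1 - fps_X ^ (2 * i)) * inverse (qfact i)" for i
    using inverse_qfact_Suc[of "i - 1"] by (cases i) (simp_all add: h_def)
  have "qmultinom a b c = qfact s * (1 - fps_X ^ (2 * (a + b + c)))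
      * inverse (qfact a) * inverse (qfact b) * inverse (qfact c)"
    unfolding qmultinom_def s qfact_Suc by (simp add: mult_ac)
  also have "\<dots> = qfact s * h a * inverse (qfact b) * inverse (qfact c)
      + fps_X ^ (2 * (a + c)) * (qfact s * inverse (qfact a) * h b * inverse (qfact c))
      + fps_X ^ (2 * a) * (qfact s * inverse (qfact a) * inverse (qfact b) * h c)"
    by (simp add: h algebra_simps power_add)
  also have "qfact s * h a * inverse (qfact b) * inverse (qfact c) =
      (if a = 0 then 0 else qmultinom (a - 1) b c)"
    using s by (cases a) (auto simp: h_def qmultinom_def)
  also have "qfact s * inverse (qfact a) * h b * inverse (qfact c) =
      (if b = 0 then 0 else qmultinom a (b - 1) c)"
    using s by (cases b) (auto simp: h_def qmultinom_def)
  also have "qfact s * inverse (qfact a) * inverse (qfact b) * h c =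
      (if c = 0 then 0 else qmultinom a b (c - 1))"
    using s by (cases c) (auto simp: h_def qmultinom_def)
  finally show ?thesis .
qed

text \<open>The \<open>q\<close>-multinomial Pascal rule, with the parts \<open>a = m + 2 - j - k\<close>, \<open>b = j - k\<close> and \<open>k\<close>: lowering
  \<open>a\<close>, \<open>b\<close> or \<open>k\<close> by 1 corresponds to \<open>(m + 1, j, k)\<close>, \<open>(m + 1, j - 1, k)\<close> or \<open>(m, j - 1, k - 1)\<close>.
  The quadratic exponent \<open>j\<^sup>2 + k\<^sup>2 + 2 j\<close> is what makes the resulting powers of \<open>q\<close> independent
  of \<open>j\<close> and \<open>k\<close>.\<close>

lemma summand_rec:
  "summand (Suc (Suc m)) j k = summand (Suc m) j k
    + fps_X ^ (2 * m + 5) * (case j of 0 \<Rightarrow> 0 | Suc j' \<Rightarrow> summand (Suc m) j' k)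
    + fps_X ^ (2 * m + 4) * (case j of 0 \<Rightarrow> 0 | Suc j' \<Rightarrow> (case k of 0 \<Rightarrow> 0 | Suc k' \<Rightarrow> summand m j' k'))"
proof (cases "k \<le> j \<and> j + k \<le> m + 2")
  case True
  define a b where "a = m + 2 - j - k" and "b = j - k"
  have j: "j = b + k" and m: "m + 2 = a + b + 2 * k"
    using True by (auto simp: a_def b_def)
  let ?e = "j^2 + k^2 + 2 * j"
  have "summand (Suc (Suc m)) j k = fps_X ^ ?e * qmultinom a b k"
    using True by (simp add: summand_eq a_def b_def)
  also have "\<dots> = fps_X ^ ?e * (if a = 0 then 0 else qmultinom (a - 1) b k)
    + fps_X ^ (?e + 2 * (a + k)) * (if b = 0 then 0 else qmultinom a (b - 1) k)
    + fps_X ^ (?e + 2 * a) * (if k = 0 then 0 else qmultinom a b (k - 1))"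
    using m by (subst qmultinom_rec) (auto simp: distrib_left power_add mult.assoc)
  also have "fps_X ^ ?e * (if a = 0 then 0 else qmultinom (a - 1) b k) = summand (Suc m) j k"
    using True by (auto simp: summand_eq a_def b_def)
  also have "fps_X ^ (?e + 2 * (a + k)) * (if b = 0 then 0 else qmultinom a (b - 1) k) =
      fps_X ^ (2 * m + 5) * (case j of 0 \<Rightarrow> 0 | Suc j' \<Rightarrow> summand (Suc m) j' k)"
  proof (cases b)
    case (Suc b')
    have e: "?e + 2 * (a + k) = 2 * m + 5 + ((b' + k)^2 + k^2 + 2 * (b' + k))"
      using j m Suc by (simp add: power2_eq_square algebra_simps)
    have "Suc m - (b' + k) - k = a"
      using m Suc by simp
    then show ?thesis
      using j m Suc unfolding e by (simp add: summand_eq power_add mult.assoc)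
  qed (auto simp: j summand_eq split: nat.split)
  also have "fps_X ^ (?e + 2 * a) * (if k = 0 then 0 else qmultinom a b (k - 1)) =
      fps_X ^ (2 * m + 4) * (case j of 0 \<Rightarrow> 0 | Suc j' \<Rightarrow> (case k of 0 \<Rightarrow> 0 | Suc k' \<Rightarrow> summand m j' k'))"
  proof (cases k)
    case (Suc k')
    have e: "?e + 2 * a = 2 * m + 4 + ((b + k')^2 + k'^2 + 2 * (b + k'))"
      using j m Suc by (simp add: power2_eq_square algebra_simps)
    have "summand m (b + k') k' = fps_X ^ ((b + k')^2 + k'^2 + 2 * (b + k')) * qmultinom a b k'"
      using m Suc by (simp add: summand_eq)
    then have "fps_X ^ (?e + 2 * a) * qmultinom a b k' = fps_X ^ (2 * m + 4) * summand m (b + k') k'"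
      unfolding e power_add[of _ "2 * m + 4"] by (simp only: mult.assoc)
    then show ?thesis
      by (simp add: j Suc)
  qed (auto split: nat.split)
  finally show ?thesis .
qed (auto simp: summand_eq split: nat.split)

text \<open>The terms at \<open>m\<close> vanish outside the square of side \<open>m\<close>, so the sums at \<open>m\<close>, \<open>m + 1\<close> and
  \<open>m + 2\<close>, shifted or not, can all be taken over rectangles of convenient size.\<close>

lemma sum_summand_box:
  assumes "m \<le> J" "m \<le> K"
  shows "(\<Sum>j\<le>J. \<Sum>k\<le>K. summand m j k) = (\<Sum>j\<le>m. \<Sum>k\<le>m. summand m j k)"
  by (intro sum.mono_neutral_cong_right ballI sum.neutral)
     (use assms in \<open>auto simp: summand_eq_0\<close>)

lemma sum_shift: "(\<Sum>j\<le>Suc J. case j of 0 \<Rightarrow> 0 | Suc j' \<Rightarrow> f j') = (\<Sum>j\<le>J. f j)"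
  for f :: "nat \<Rightarrow> 'a::comm_monoid_add"
  by (simp add: sum.atMost_Suc_shift del: sum.atMost_Suc)

lemma sum_summand_rec:
  fixes m :: nat
  defines "S \<equiv> \<lambda>m. \<Sum>j\<le>m. \<Sum>k\<le>m. summand m j k"
  shows "S (Suc (Suc m)) = (1 + fps_X ^ (2 * m + 5)) * S (Suc m) + fps_X ^ (2 * m + 4) * S m"
proof -
  let ?J = "Suc (Suc m)"
  have "(\<Sum>j\<le>?J. \<Sum>k\<le>?J. case j of 0 \<Rightarrow> 0 | Suc j' \<Rightarrow> summand (Suc m) j' k)
      = (\<Sum>j\<le>?J. case j of 0 \<Rightarrow> 0 | Suc j' \<Rightarrow> \<Sum>k\<le>?J. summand (Suc m) j' k)"
    by (intro sum.cong refl) (auto split: nat.split)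
  also have "\<dots> = S (Suc m)"
    unfolding sum_shift S_def by (rule sum_summand_box) auto
  finally have 1: "(\<Sum>j\<le>?J. \<Sum>k\<le>?J. case j of 0 \<Rightarrow> 0 | Suc j' \<Rightarrow> summand (Suc m) j' k) = S (Suc m)" .
  have "(\<Sum>j\<le>?J. \<Sum>k\<le>?J. case j of 0 \<Rightarrow> 0
        | Suc j' \<Rightarrow> (case k of 0 \<Rightarrow> 0 | Suc k' \<Rightarrow> summand m j' k'))
      = (\<Sum>j\<le>?J. case j of 0 \<Rightarrow> 0
        | Suc j' \<Rightarrow> \<Sum>k\<le>?J. case k of 0 \<Rightarrow> 0 | Suc k' \<Rightarrow> summand m j' k')"
    by (intro sum.cong refl) (auto split: nat.split)
  also have "\<dots> = S m"
    unfolding sum_shift S_def by (rule sum_summand_box) auto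
  finally have 2: "(\<Sum>j\<le>?J. \<Sum>k\<le>?J. case j of 0 \<Rightarrow> 0
        | Suc j' \<Rightarrow> (case k of 0 \<Rightarrow> 0 | Suc k' \<Rightarrow> summand m j' k')) = S m" .
  have 0: "(\<Sum>j\<le>?J. \<Sum>k\<le>?J. summand (Suc m) j k) = S (Suc m)"
    unfolding S_def by (rule sum_summand_box) auto
  have "S ?J = (\<Sum>j\<le>?J. \<Sum>k\<le>?J. summand (Suc m) j k)
    + fps_X ^ (2 * m + 5) * (\<Sum>j\<le>?J. \<Sum>k\<le>?J. case j of 0 \<Rightarrow> 0 | Suc j' \<Rightarrow> summand (Suc m) j' k)
    + fps_X ^ (2 * m + 4) * (\<Sum>j\<le>?J. \<Sum>k\<le>?J. case j of 0 \<Rightarrow> 0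
        | Suc j' \<Rightarrow> (case k of 0 \<Rightarrow> 0 | Suc k' \<Rightarrow> summand m j' k'))"
    unfolding S_def summand_rec sum.distrib sum_distrib_left ..
  then show ?thesis
    unfolding 0 1 2 by (simp add: algebra_simps)
qed

lemma sum_summand_eq_band_poly: "(\<Sum>j\<le>m. \<Sum>k\<le>m. summand m j k) = band_poly m"
proof (induction m rule: band_poly.induct)
  case 2
  show ?case
    using qfact_mult_inverse[of 1]
    by (simp add: summand_eq qmultinom_def qfact_def qpoch_def power3_eq_cube mult.assoc)
next
  case (3 m)
  then show ?case
    by (simp only: sum_summand_rec band_poly.simps)
qed (simp add: summand_eq qmultinom_def qfact_def qpoch_def)

theorem theorem4p5:
  fixes n :: nat
  assumes "n \<ge> 1"
  shows "((\<lambda>(j, k). fps_X ^ (j^2 + k^2 + 2 * j)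
             * qbinom (fps_X^2) (2 * int n - int k - 2) (int j)
             * qbinom (fps_X^2) (int j) (int k)) has_sum P000 n) (UNIV :: (nat \<times> nat) set)"
proof -
  obtain e where n: "n = Suc e"
    using assms by (cases n) auto
  let ?m = "2 * e"
  have "2 * int n - int k - 2 = int ?m - int k" for k
    by (simp add: n)
  then have summand: "(\<lambda>(j, k). fps_X ^ (j^2 + k^2 + 2 * j)
             * qbinom (fps_X^2) (2 * int n - int k - 2) (int j)
             * qbinom (fps_X^2) (int j) (int k)) = (\<lambda>(j, k). summand ?m j k)"
    by (simp only: summand_def)
  have "P000 n = (\<Sum>(j, k)\<in>{..?m} \<times> {..?m}. summand ?m j k)"
    using num_eq_band_poly[of e]
    by (simp add: P000_eq_num n num_full_rows sum_summand_eq_band_poly sum.cartesian_product[symmetric])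
  then have "((\<lambda>(j, k). summand ?m j k) has_sum P000 n) ({..?m} \<times> {..?m})"
    by (intro has_sum_finiteI) auto
  then have "((\<lambda>(j, k). summand ?m j k) has_sum P000 n) UNIV"
    by (rule has_sum_cong_neutral[THEN iffD1, rotated -1])
       (auto simp: summand_eq split: if_splits)
  then show ?thesis
    unfolding summand .
qed

end
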